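(* Let $k\ge 1$ be an integer and let $G=(V,E)$ be a $k$-intersection polished graph. Then every set $S\subseteq V$ with $|S|=k$ is contained in at most one maximal clique of $G$.
   Context: All graphs are finite and simple. For a vertex $v$, $N[v]$ denotes its closed neighbourhood (the set of neighbours of $v$ together with $v$). For an integer $k$, $P^k(G)$ is the graph on the same vertex set as $G$ in which two distinct vertices $u,v$ are adjacent if and only if $|N[u]\cap N[v]|\ge k$, the closed neighbourhoods being taken in $G$. A graph $G$ is called $k$-intersection polished if $P^k(G)=G$. A clique is a set of pairwise adjacent vertices; it is maximal if it is not properly contained in another clique. *)

theory Defs
  imports Main
begin

definition simple_graph :: "'a set \<Rightarrow> ('a \<Rightarrow> 'a \<Rightarrow> bool) \<Rightarrow> bool" where
  "simple_graph V E \<longleftrightarrow> finite V \<and> (\<forall>u v. E u v \<longrightarrow> u \<in> V \<and> v \<in> V) \<and>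
     (\<forall>u v. E u v \<longrightarrow> E v u) \<and> (\<forall>v. \<not> E v v)"

definition closed_nbhd :: "'a set \<Rightarrow> ('a \<Rightarrow> 'a \<Rightarrow> bool) \<Rightarrow> 'a \<Rightarrow> 'a set" where
  "closed_nbhd V E v = insert v {u \<in> V. E v u}"

definition Pk_edge :: "nat \<Rightarrow> 'a set \<Rightarrow> ('a \<Rightarrow> 'a \<Rightarrow> bool) \<Rightarrow> 'a \<Rightarrow> 'a \<Rightarrow> bool" where
  "Pk_edge k V E u v \<longleftrightarrow> u \<in> V \<and> v \<in> V \<and> u \<noteq> v \<and>
     card (closed_nbhd V E u \<inter> closed_nbhd V E v) \<ge> k"

definition k_intersection_polished :: "nat \<Rightarrow> 'a set \<Rightarrow> ('a \<Rightarrow> 'a \<Rightarrow> bool) \<Rightarrow> bool" where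
  "k_intersection_polished k V E \<longleftrightarrow> Pk_edge k V E = E"

definition is_clique :: "'a set \<Rightarrow> ('a \<Rightarrow> 'a \<Rightarrow> bool) \<Rightarrow> 'a set \<Rightarrow> bool" where
  "is_clique V E C \<longleftrightarrow> C \<subseteq> V \<and> (\<forall>u\<in>C. \<forall>v\<in>C. u \<noteq> v \<longrightarrow> E u v)"

definition is_maximal_clique :: "'a set \<Rightarrow> ('a \<Rightarrow> 'a \<Rightarrow> bool) \<Rightarrow> 'a set \<Rightarrow> bool" where
  "is_maximal_clique V E C \<longleftrightarrow> is_clique V E C \<and> (\<forall>D. is_clique V E D \<and> C \<subseteq> D \<longrightarrow> D = C)"

end

theory Submission
  imports Defs
begin

text \<open>Every vertex of a clique containing S has S in its closed neighbourhood. So if S lies in two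
  cliques C1 and C2, any u \<in> C1 and v \<in> C2 share at least |S| = k closed neighbours, and
  k-intersection polishedness makes them adjacent. Hence C1 \<union> C2 is a clique, and maximality
  forces C1 = C2.\<close>

lemma clique_subset_closed_nbhd:
  assumes "is_clique V E C" and "S \<subseteq> C" and "u \<in> C"
  shows "S \<subseteq> closed_nbhd V E u"
  using assms unfolding is_clique_def closed_nbhd_def by auto

lemma polished_adjacent_if_common_closed_nbhd:
  assumes "finite V" and "k_intersection_polished k V E"
    and "u \<in> V" and "v \<in> V" and "u \<noteq> v"
    and "S \<subseteq> closed_nbhd V E u \<inter> closed_nbhd V E v" and "k \<le> card S"
  shows "E u v"
proof -
  have "finite (closed_nbhd V E u \<inter> closed_nbhd V E v)"
    using assms(1) unfolding closed_nbhd_def by auto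
  then have "card S \<le> card (closed_nbhd V E u \<inter> closed_nbhd V E v)"
    using assms(6) by (rule card_mono)
  then have "k \<le> card (closed_nbhd V E u \<inter> closed_nbhd V E v)"
    using assms(7) by linarith
  then have "Pk_edge k V E u v"
    using assms(3-5) unfolding Pk_edge_def by blast
  then show ?thesis
    using assms(2) unfolding k_intersection_polished_def by simp
qed

lemma clique_Un:
  assumes "symp E" and "is_clique V E C1" and "is_clique V E C2"
    and cross: "\<And>u v. u \<in> C1 \<Longrightarrow> v \<in> C2 \<Longrightarrow> u \<noteq> v \<Longrightarrow> E u v"
  shows "is_clique V E (C1 \<union> C2)"
  unfolding is_clique_def
proof (intro conjI ballI impI)
  show "C1 \<union> C2 \<subseteq> V"
    using assms(2,3) unfolding is_clique_def by blast
next
  fix u v assume "u \<in> C1 \<union> C2" "v \<in> C1 \<union> C2" "u \<noteq> v"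
  moreover have "E v u" if "u \<in> C1" "v \<in> C2" "u \<noteq> v" for u v
    using assms(1) cross[OF that] by (rule sympD)
  ultimately show "E u v"
    using assms(2,3) cross unfolding is_clique_def by blast
qed

lemma maximal_cliques_eq_if_clique_Un:
  assumes "is_maximal_clique V E C1" and "is_maximal_clique V E C2"
    and "is_clique V E (C1 \<union> C2)"
  shows "C1 = C2"
proof -
  have "C1 \<union> C2 = C1" "C1 \<union> C2 = C2"
    using assms unfolding is_maximal_clique_def by auto
  then show ?thesis by blast
qed

theorem mainTheorem3:
  fixes k :: nat and V :: "'a set" and E :: "'a \<Rightarrow> 'a \<Rightarrow> bool" and S :: "'a set"
  assumes "k \<ge> 1"
    and "simple_graph V E"
    and "k_intersection_polished k V E"
    and "S \<subseteq> V" and "card S = k"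
  shows "\<forall>C1 C2. is_maximal_clique V E C1 \<and> is_maximal_clique V E C2 \<and> S \<subseteq> C1 \<and> S \<subseteq> C2
           \<longrightarrow> C1 = C2"
proof (intro allI impI)
  fix C1 C2
  assume "is_maximal_clique V E C1 \<and> is_maximal_clique V E C2 \<and> S \<subseteq> C1 \<and> S \<subseteq> C2"
  then have max1: "is_maximal_clique V E C1" and max2: "is_maximal_clique V E C2"
    and S1: "S \<subseteq> C1" and S2: "S \<subseteq> C2" by auto
  then have cl1: "is_clique V E C1" and cl2: "is_clique V E C2"
    unfolding is_maximal_clique_def by auto
  have "finite V" and "symp E"
    using assms(2) unfolding simple_graph_def symp_def by auto
  have "E u v" if "u \<in> C1" "v \<in> C2" "u \<noteq> v" for u v
  proof (rule polished_adjacent_if_common_closed_nbhd[OF \<open>finite V\<close> assms(3) _ _ \<open>u \<noteq> v\<close>])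
    show "u \<in> V" "v \<in> V" using cl1 cl2 that unfolding is_clique_def by auto
    show "S \<subseteq> closed_nbhd V E u \<inter> closed_nbhd V E v"
      using clique_subset_closed_nbhd[OF cl1 S1 \<open>u \<in> C1\<close>]
        clique_subset_closed_nbhd[OF cl2 S2 \<open>v \<in> C2\<close>] by blast
  qed (use assms(5) in simp)
  then have "is_clique V E (C1 \<union> C2)"
    using clique_Un[OF \<open>symp E\<close> cl1 cl2] by blast
  then show "C1 = C2"
    using maximal_cliques_eq_if_clique_Un[OF max1 max2] by blast
qed

end
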